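(* Let $N\ge 1$ be an integer, $\lambda>1$, $c_0,\dots,c_N\in\mathbb{C}$ and $\beta_0<\beta_1<\dots<\beta_N$ real numbers, and consider the two-scale difference equation $$\phi(x)=\sum_{k=0}^{N}c_k\,\phi(\lambda x-\beta_k)\quad\text{for almost every }x\in\mathbb{R}.\qquad(\ast)$$ (a) Suppose $\phi\in L^1(\mathbb{R})\setminus\{0\}$ is a compactly supported solution of $(\ast)$ and $\mu\ge0$. If $\phi$ is Hölder continuous with exponent $\mu$, or if $\mu$ is an integer and $\phi\in C^{\mu}(\mathbb{R})$, then $$\mu\le\frac{\min(-\ln|c_0|,\,-\ln|c_N|)}{\ln\lambda}.$$ (b) Equation $(\ast)$ has no solution in $C^{\infty}_c(\mathbb{R})\setminus\{0\}$.
   Context: A function $\phi$ on $\mathbb{R}$ is Hölder continuous with exponent $\mu\ge 0$ if there is $M>0$ such that $|\phi(x)-\phi(y)|\le M|x-y|^{\mu}$ for all $x,y\in\mathbb{R}$. For an integer $\mu\ge0$, $C^{\mu}(\mathbb{R})$ is the space of $\mu$ times continuously differentiable functions (continuous functions if $\mu=0$), and $C_c^\infty(\mathbb{R})$ is the space of compactly supported infinitely differentiable complex-valued functions. Convention: $-\ln 0=+\infty$. *)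

theory Defs
  imports "HOL-Analysis.Analysis"
begin

definition two_scale_solution ::
  "nat \<Rightarrow> real \<Rightarrow> (nat \<Rightarrow> complex) \<Rightarrow> (nat \<Rightarrow> real) \<Rightarrow> (real \<Rightarrow> complex) \<Rightarrow> bool" where
  "two_scale_solution N lam c \<beta> \<phi> \<longleftrightarrow>
     (AE x in lebesgue. \<phi> x = (\<Sum>k=0..N. c k * \<phi> (lam * x - \<beta> k)))"

text \<open>
  An element of \<open>L\<^sup>1\<close> is represented by any of its representatives, so the notions applied
  to it (being nonzero, having compact support) must not depend on the values on a null set.
\<close>

definition L1_nonzero :: "(real \<Rightarrow> complex) \<Rightarrow> bool" where
  "L1_nonzero \<phi> \<longleftrightarrow> integrable lebesgue \<phi> \<and> \<not> (AE x in lebesgue. \<phi> x = 0)"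

definition ess_compactly_supported :: "(real \<Rightarrow> complex) \<Rightarrow> bool" where
  "ess_compactly_supported \<phi> \<longleftrightarrow> (\<exists>K. compact K \<and> (AE x in lebesgue. x \<notin> K \<longrightarrow> \<phi> x = 0))"

text \<open>
  The library convention \<open>0 powr 0 = 0\<close> is harmless here: for \<open>x = y\<close> the left-hand side
  vanishes, so exponent \<open>0\<close> still means that the function is bounded.
\<close>

definition hoelder_continuous :: "real \<Rightarrow> (real \<Rightarrow> complex) \<Rightarrow> bool" where
  "hoelder_continuous \<mu> \<phi> \<longleftrightarrow> (\<exists>M>0. \<forall>x y. cmod (\<phi> x - \<phi> y) \<le> M * \<bar>x - y\<bar> powr \<mu>)"

primrec C_diff :: "nat \<Rightarrow> (real \<Rightarrow> complex) \<Rightarrow> bool" where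
  "C_diff 0 \<phi> \<longleftrightarrow> continuous_on UNIV \<phi>"
| "C_diff (Suc m) \<phi> \<longleftrightarrow> (\<exists>\<phi>'. (\<forall>x. (\<phi> has_vector_derivative \<phi>' x) (at x)) \<and> C_diff m \<phi>')"

definition Cc_infinity :: "(real \<Rightarrow> complex) set" where
  "Cc_infinity = {\<phi>. (\<forall>m. C_diff m \<phi>) \<and> compact (closure {x. \<phi> x \<noteq> 0})}"

text \<open>The function \<open>t \<mapsto> - ln t\<close> with value \<open>\<infinity>\<close> at \<open>0\<close> (the library has \<open>ln 0 = 0\<close>).\<close>

definition neg_ln :: "real \<Rightarrow> ereal" where
  "neg_ln t = (if t = 0 then \<infinity> else ereal (- ln t))"

end

theory Submission
  imports Defs
begin

text \<open>
  Let \<open>a\<close> be the left endpoint of the essential support of \<open>\<phi>\<close>. For \<open>x\<close> slightly to the right of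
  \<open>a\<close> only the smallest shift contributes, so the equation forces \<open>lam * a - \<beta> 0 = a\<close> and reduces
  to \<open>\<phi> (a + x) = c 0 * \<phi> (a + lam * x)\<close>. Iterating towards \<open>a\<close>, the values
  \<open>\<phi> (a + x / lam ^ n)\<close> decay exactly like \<open>c 0 ^ n\<close>, whereas regularity of order \<open>\<mu>\<close>, together
  with vanishing to the left of \<open>a\<close>, bounds them by a multiple of \<open>lam powr (- n * \<mu>)\<close>. Hence
  \<open>cmod (c 0) * lam powr \<mu> \<le> 1\<close>. The bound for \<open>c N\<close> follows by the reflection
  \<open>x \<mapsto> - x\<close>. For a smooth solution the bound applies for all \<open>\<mu>\<close> to the first nonzero coefficient,
  which is absurd.
\<close>

section \<open>Null sets, affine substitutions and continuity\<close>

text \<open>Lebesgue measure is complete, so a subset of a null set is null and the exceptional set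
  itself can be used for any \<open>P\<close>.\<close>

lemma AE_lebesgue_iff_negligible:
  "(AE x in lebesgue. P x) \<longleftrightarrow> negligible {x :: real. \<not> P x}"
  unfolding negligible_iff_null_sets eventually_ae_filter
  using null_sets_completion_subset[of "{x. \<not> P x}" _ lborel] by auto

text \<open>The new exceptional set lies in the image of the old one under the inverse affine map,
  and differentiable maps preserve negligible sets.\<close>

lemma AE_lebesgue_affine:
  fixes s t :: real
  assumes "AE x in lebesgue. P x" "s \<noteq> 0"
  shows "AE x in lebesgue. P (s * x + t)"
proof -
  have "negligible ((\<lambda>y. (y - t) / s) ` {x. \<not> P x})"
    using assms(1) unfolding AE_lebesgue_iff_negligible
    by (intro negligible_differentiable_image_negligible) (auto intro!: derivative_intros simp: differentiable_on_def assms(2))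
  moreover have "{x. \<not> P (s * x + t)} \<subseteq> (\<lambda>y. (y - t) / s) ` {x. \<not> P x}"
    using assms(2) by (force simp: image_iff)
  ultimately show ?thesis
    unfolding AE_lebesgue_iff_negligible by (rule negligible_subset)
qed

lemma eventually_witness:
  assumes "eventually P F" "\<not> eventually Q F"
  obtains x where "P x" "\<not> Q x"
  using assms by (metis (mono_tags, lifting) eventually_mono)

text \<open>A nonzero value inside \<open>S\<close> would persist on a nonempty open set, which is
  never negligible.\<close>

lemma continuous_AE_zero_imp_zero:
  fixes f :: "real \<Rightarrow> complex"
  assumes "continuous_on UNIV f" "open S" "AE x in lebesgue. x \<in> S \<longrightarrow> f x = 0" "x \<in> S"
  shows "f x = 0"
proof (rule ccontr)
  assume "f x \<noteq> 0"
  have "open (S \<inter> f -` (- {0}))"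
    using assms(1,2) by (intro open_Int open_vimage) auto
  moreover have "negligible (S \<inter> f -` (- {0}))"
    using assms(3) unfolding AE_lebesgue_iff_negligible by (rule negligible_subset) auto
  ultimately show False
    using open_not_negligible[of "S \<inter> f -` (- {0})"] \<open>f x \<noteq> 0\<close> assms(4) by auto
qed

section \<open>The left edge of the essential support and scaling there\<close>

text \<open>The edge is the supremum of all \<open>t\<close> to the left of which \<open>f\<close>
  vanishes almost everywhere. It is attained because a countable union of null sets is null, and it
  is finite because \<open>f\<close> is not zero almost everywhere.\<close>

lemma left_edge_exists:
  fixes f :: "real \<Rightarrow> complex"
  assumes "AE x in lebesgue. x < t0 \<longrightarrow> f x = 0" "\<not> (AE x in lebesgue. f x = 0)"
  obtains a where "AE x in lebesgue. x < a \<longrightarrow> f x = 0"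
    "\<And>t. t > a \<Longrightarrow> \<not> (AE x in lebesgue. x < t \<longrightarrow> f x = 0)"
proof -
  define Z where "Z = {t. AE x in lebesgue. x < t \<longrightarrow> f x = 0}"
  have down: "s \<in> Z" if "t \<in> Z" "s \<le> t" for s t
    using that unfolding Z_def by (auto elim!: eventually_mono)
  have sup: "t \<in> Z" if "\<And>n. g n \<in> Z" "\<And>x. x < t \<Longrightarrow> \<exists>n. x < g n" for g :: "nat \<Rightarrow> real" and t
  proof -
    have "AE x in lebesgue. \<forall>n. x < g n \<longrightarrow> f x = 0"
      unfolding AE_all_countable using that(1) by (simp add: Z_def)
    then show ?thesis
      unfolding Z_def mem_Collect_eq by (rule eventually_mono) (use that(2) in blast)
  qed
  have "bdd_above Z"
  proof (rule ccontr)
    assume nb: "\<not> bdd_above Z"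
    have "real n \<in> Z" for n
      using nb down by (meson bdd_above.I linorder_le_cases)
    then have "AE x in lebesgue. \<forall>n. x < real n \<longrightarrow> f x = 0"
      unfolding AE_all_countable by (simp add: Z_def)
    then have "AE x in lebesgue. f x = 0"
      by (rule eventually_mono) (meson reals_Archimedean2)
    with assms(2) show False ..
  qed
  have "t0 \<in> Z" using assms(1) by (simp add: Z_def)
  have "Sup Z \<in> Z"
  proof (rule sup)
    fix n :: nat
    obtain t where "t \<in> Z" "Sup Z - inverse (real (Suc n)) < t"
      using less_cSup_iff[of Z "Sup Z - inverse (real (Suc n))"] \<open>bdd_above Z\<close> \<open>t0 \<in> Z\<close> by auto
    then show "Sup Z - inverse (real (Suc n)) \<in> Z"
      using down by (meson less_imp_le)
  next
    fix x assume "x < Sup Z"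
    then show "\<exists>n. x < Sup Z - inverse (real (Suc n))"
      using reals_Archimedean[of "Sup Z - x"] by (auto simp: algebra_simps)
  qed
  moreover have "t \<notin> Z" if "t > Sup Z" for t
    using cSup_upper[OF _ \<open>bdd_above Z\<close>] that by (meson not_less)
  ultimately show thesis
    using that by (auto simp: Z_def)
qed

lemma two_scale_at_left_edge:
  fixes \<phi> :: "real \<Rightarrow> complex"
  assumes "lam > 1" and "two_scale_solution N lam c \<beta> \<phi>"
    and "k0 \<le> N" "c k0 \<noteq> 0"
    and min: "\<And>k. k \<le> N \<Longrightarrow> k \<noteq> k0 \<Longrightarrow> c k \<noteq> 0 \<Longrightarrow> \<beta> k0 < \<beta> k"
    and a: "AE x in lebesgue. x < a \<longrightarrow> \<phi> x = 0"
    and a_max: "\<And>t. t > a \<Longrightarrow> \<not> (AE x in lebesgue. x < t \<longrightarrow> \<phi> x = 0)"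
  obtains \<delta> where "\<delta> > 0" "AE x in lebesgue. x < \<delta> \<longrightarrow> \<phi> (a + x) = c k0 * \<phi> (a + lam * x)"
proof -
  define J where "J = {k \<in> {0..N} - {k0}. c k \<noteq> 0}"
  \<comment> \<open>The gap between the shift \<open>\<beta> k0\<close> and the next one with
    nonzero coefficient; the extra element \<open>\<beta> k0 + 1\<close> keeps the minimum
    meaningful when \<open>J\<close> is empty.\<close>
  define d where "d = Min (insert (\<beta> k0 + 1) (\<beta> ` J)) - \<beta> k0"
  have "finite J" by (simp add: J_def)
  have "d > 0"
    using min \<open>finite J\<close> by (auto simp: d_def J_def)
  have d_le: "\<beta> k0 + d \<le> \<beta> k" if "k \<in> J" for k
    using that \<open>finite J\<close> by (auto simp: d_def)
  have "AE x in lebesgue. \<forall>k. lam * x - \<beta> k < a \<longrightarrow> \<phi> (lam * x - \<beta> k) = 0"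
    unfolding AE_all_countable
    using AE_lebesgue_affine[OF a, of lam "- \<beta> _"] \<open>lam > 1\<close> by simp
  then have eq: "AE x in lebesgue. lam * x < a + \<beta> k0 + d \<longrightarrow> \<phi> x = c k0 * \<phi> (lam * x - \<beta> k0)"
    using assms(2) unfolding two_scale_solution_def
  proof eventually_elim
    case (elim x)
    show ?case
    proof
      assume x: "lam * x < a + \<beta> k0 + d"
      have "(\<Sum>k=0..N. c k * \<phi> (lam * x - \<beta> k)) = (\<Sum>k\<in>{k0}. c k * \<phi> (lam * x - \<beta> k))"
      proof (rule sum.mono_neutral_right)
        show "\<forall>k\<in>{0..N} - {k0}. c k * \<phi> (lam * x - \<beta> k) = 0"
        proof
          fix k assume "k \<in> {0..N} - {k0}"
          then have "c k = 0 \<or> lam * x - \<beta> k < a"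
            using d_le[of k] x by (cases "c k = 0") (auto simp: J_def)
          then show "c k * \<phi> (lam * x - \<beta> k) = 0" using elim(1) by auto
        qed
      qed (use \<open>k0 \<le> N\<close> in auto)
      with elim(2) show "\<phi> x = c k0 * \<phi> (lam * x - \<beta> k0)" by simp
    qed
  qed
  have a_eq: "lam * a = a + \<beta> k0"
  proof (rule antisym)
    \<comment> \<open>If \<open>lam * a < a + \<beta> k0\<close>, the one-term equation would carry
      the vanishing of \<open>\<phi>\<close> beyond \<open>a\<close>, up to
      \<open>(a + \<beta> k0) / lam\<close>.\<close>
    have "AE x in lebesgue. lam * x - \<beta> k0 < a \<longrightarrow> \<phi> (lam * x - \<beta> k0) = 0"
      using AE_lebesgue_affine[OF a, of lam "- \<beta> k0"] \<open>lam > 1\<close> by simp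
    with eq have "AE x in lebesgue. x < (a + \<beta> k0) / lam \<longrightarrow> \<phi> x = 0"
    proof eventually_elim
      case (elim x)
      then show ?case using \<open>lam > 1\<close> \<open>d > 0\<close> by (auto simp: field_simps)
    qed
    then have "(a + \<beta> k0) / lam \<le> a" using a_max by (meson not_less)
    then show "a + \<beta> k0 \<le> lam * a" using \<open>lam > 1\<close> by (simp add: field_simps)
  next
    \<comment> \<open>For the other inequality the equation is read backwards: as
      \<open>c k0\<close> is nonzero, \<open>\<phi> y\<close> vanishes whenever
      \<open>\<phi> ((y + \<beta> k0) / lam)\<close> does.\<close>
    have *: "1 / lam * y + \<beta> k0 / lam = (y + \<beta> k0) / lam" for y
      by (simp add: add_divide_distrib)
    have inv: "AE y in lebesgue. y < a + d \<longrightarrow> \<phi> ((y + \<beta> k0) / lam) = c k0 * \<phi> y"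
      using AE_lebesgue_affine[OF eq, of "1 / lam" "\<beta> k0 / lam"] \<open>lam > 1\<close>
      unfolding * by (simp add: add.commute add.left_commute)
    have "(y + \<beta> k0) / lam < a \<longleftrightarrow> y < lam * a - \<beta> k0" for y
      using \<open>lam > 1\<close> by (simp add: field_simps)
    then have "AE y in lebesgue. y < lam * a - \<beta> k0 \<longrightarrow> \<phi> ((y + \<beta> k0) / lam) = 0"
      using AE_lebesgue_affine[OF a, of "1 / lam" "\<beta> k0 / lam"] \<open>lam > 1\<close> unfolding * by simp
    with inv have "AE y in lebesgue. y < min (a + d) (lam * a - \<beta> k0) \<longrightarrow> \<phi> y = 0"
      by eventually_elim (use \<open>c k0 \<noteq> 0\<close> in \<open>metis min_less_iff_conj mult_eq_0_iff\<close>)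
    then have "min (a + d) (lam * a - \<beta> k0) \<le> a" using a_max by (meson not_less)
    then show "lam * a \<le> a + \<beta> k0" using \<open>d > 0\<close> by (auto simp: min_def split: if_splits)
  qed
  show thesis
  proof
    show "d / lam > 0" using \<open>d > 0\<close> \<open>lam > 1\<close> by simp
    have *: "lam * (x + a) = a + \<beta> k0 + lam * x" for x using a_eq by (simp add: algebra_simps)
    show "AE x in lebesgue. x < d / lam \<longrightarrow> \<phi> (a + x) = c k0 * \<phi> (a + lam * x)"
      using AE_lebesgue_affine[OF eq, of 1 a] \<open>lam > 1\<close> by (simp add: * field_simps add.commute)
  qed
qed

text \<open>The scaling relation is iterated along the orbit \<open>x / lam ^ n\<close> of one point
  with \<open>\<psi> x \<noteq> 0\<close>. Comparison with the power bound keeps all powers of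
  \<open>cmod q * lam powr \<mu>\<close> below a constant independent of \<open>n\<close>.\<close>

lemma scaling_factor_le:
  fixes \<psi> :: "real \<Rightarrow> complex" and q :: complex
  assumes "lam > 1" "\<delta> > 0"
    and neg: "AE x in lebesgue. x < 0 \<longrightarrow> \<psi> x = 0"
    and nz: "\<And>t. t > 0 \<Longrightarrow> \<not> (AE x in lebesgue. x < t \<longrightarrow> \<psi> x = 0)"
    and scal: "AE x in lebesgue. x < \<delta> \<longrightarrow> \<psi> x = q * \<psi> (lam * x)"
    and bound: "AE x in lebesgue. 0 < x \<and> x < 1 \<longrightarrow> cmod (\<psi> x) \<le> C * x powr \<mu>"
  shows "cmod q * lam powr \<mu> \<le> 1"
proof (rule ccontr)
  assume "\<not> ?thesis"
  then have gt: "cmod q * lam powr \<mu> > 1" by simp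
  \<comment> \<open>Only countably many scales occur, so almost every point satisfies the relations
    at all of them simultaneously.\<close>
  have "AE x in lebesgue. \<forall>n. inverse lam ^ n * x < \<delta> \<longrightarrow>
          \<psi> (inverse lam ^ n * x) = q * \<psi> (lam * (inverse lam ^ n * x))"
    unfolding AE_all_countable
    using AE_lebesgue_affine[OF scal, of "inverse lam ^ _" 0] \<open>lam > 1\<close> by simp
  moreover have "AE x in lebesgue. \<forall>n. 0 < inverse lam ^ n * x \<and> inverse lam ^ n * x < 1 \<longrightarrow>
          cmod (\<psi> (inverse lam ^ n * x)) \<le> C * (inverse lam ^ n * x) powr \<mu>"
    unfolding AE_all_countable
    using AE_lebesgue_affine[OF bound, of "inverse lam ^ _" 0] \<open>lam > 1\<close> by simp
  moreover have "AE x in lebesgue. x \<noteq> (0 :: real)"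
    by (simp add: AE_lebesgue_iff_negligible)
  ultimately have "AE x in lebesgue. (x \<noteq> 0 \<and> (x < 0 \<longrightarrow> \<psi> x = 0)) \<and>
      (\<forall>n. inverse lam ^ n * x < \<delta> \<longrightarrow>
          \<psi> (inverse lam ^ n * x) = q * \<psi> (lam * (inverse lam ^ n * x))) \<and>
      (\<forall>n. 0 < inverse lam ^ n * x \<and> inverse lam ^ n * x < 1 \<longrightarrow>
          cmod (\<psi> (inverse lam ^ n * x)) \<le> C * (inverse lam ^ n * x) powr \<mu>)"
    using neg by eventually_elim blast
  \<comment> \<open>Below \<open>min \<delta> 1\<close> the whole orbit stays in the range of both
    the scaling relation and the bound.\<close>
  moreover have "\<not> (AE x in lebesgue. x < min \<delta> 1 \<longrightarrow> \<psi> x = 0)"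
    using \<open>\<delta> > 0\<close> by (intro nz) simp
  ultimately obtain x where x: "x \<noteq> 0" "x < 0 \<longrightarrow> \<psi> x = 0" "x < \<delta>" "x < 1" "\<psi> x \<noteq> 0"
    and s: "\<And>n. inverse lam ^ n * x < \<delta> \<Longrightarrow>
          \<psi> (inverse lam ^ n * x) = q * \<psi> (lam * (inverse lam ^ n * x))"
    and b: "\<And>n. 0 < inverse lam ^ n * x \<Longrightarrow> inverse lam ^ n * x < 1 \<Longrightarrow>
          cmod (\<psi> (inverse lam ^ n * x)) \<le> C * (inverse lam ^ n * x) powr \<mu>"
    by (rule eventually_witness) (simp only: min_less_iff_conj, blast)
  have "x > 0" using x by linarith
  have small: "inverse lam ^ n * x \<le> x" for n
    using \<open>lam > 1\<close> \<open>x > 0\<close> by (simp add: power_le_one inverse_le_1_iff mult_le_cancel_right1)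
  have iter: "\<psi> (inverse lam ^ n * x) = q ^ n * \<psi> x" for n
  proof (induction n)
    case (Suc n)
    have "inverse lam ^ Suc n * x < \<delta>"
      using small[of "Suc n"] x(3) by linarith
    note s[OF this]
    also have "lam * (inverse lam ^ Suc n * x) = inverse lam ^ n * x"
      using \<open>lam > 1\<close> by (simp add: field_simps)
    finally show ?case by (simp only: Suc power_Suc mult.assoc)
  qed simp
  have "(cmod q * lam powr \<mu>) ^ n \<le> C * x powr \<mu> / cmod (\<psi> x)" for n
  proof -
    have "cmod q ^ n * cmod (\<psi> x) \<le> C * (inverse lam ^ n * x) powr \<mu>"
      using b[of n] small[of n] \<open>x < 1\<close> \<open>x > 0\<close> \<open>lam > 1\<close> by (simp add: iter norm_mult norm_power)
    also have "(inverse lam ^ n * x) powr \<mu> = x powr \<mu> / (lam powr \<mu>) ^ n"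
      using \<open>lam > 1\<close> \<open>x > 0\<close>
      by (simp add: powr_mult power_inverse powr_powr powr_divide inverse_powr field_simps flip: powr_realpow)
    finally show ?thesis
      using \<open>\<psi> x \<noteq> 0\<close> \<open>lam > 1\<close> by (simp add: power_mult_distrib field_simps)
  qed
  then show False
    using real_arch_pow[OF gt] by (meson not_less)
qed

section \<open>Regularity and decay at the edge\<close>

lemma C_diff_imp_continuous: "C_diff m f \<Longrightarrow> continuous_on UNIV f"
  by (cases m) (auto intro!: continuous_at_imp_continuous_on dest: has_vector_derivative_continuous)

text \<open>The factor \<open>r\<close> closes the induction: each differentiation multiplies it by
  \<open>s\<close>.\<close>

lemma C_diff_affine:
  assumes "C_diff m f"
  shows "C_diff m (\<lambda>x. r *\<^sub>R f (s * x + t))"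
  using assms
proof (induction m arbitrary: f r)
  case 0
  then show ?case by (auto intro!: continuous_intros continuous_on_compose2[of UNIV f])
next
  case (Suc m)
  then obtain f' where f': "\<And>x. (f has_vector_derivative f' x) (at x)" "C_diff m f'" by auto
  have "((\<lambda>x. r *\<^sub>R f (s * x + t)) has_vector_derivative (r * s) *\<^sub>R f' (s * x + t)) (at x)" for x
  proof -
    have "((\<lambda>x. s * x + t) has_real_derivative s) (at x)"
      by (auto intro!: derivative_eq_intros)
    from vector_diff_chain_at[OF this[unfolded has_real_derivative_iff_has_vector_derivative] f'(1)]
    have "((\<lambda>x. f (s * x + t)) has_vector_derivative s *\<^sub>R f' (s * x + t)) (at x)"
      by (simp add: o_def)
    then show ?thesis
      by (auto intro!: derivative_eq_intros)
  qed
  with Suc.IH[OF f'(2), of "r * s"] show ?case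
    unfolding C_diff.simps by (intro exI[of _ "\<lambda>x. (r * s) *\<^sub>R f' (s * x + t)"]) blast
qed

text \<open>Induction on the order: \<open>f'\<close> also vanishes on the negative axis, and the
  mean value inequality from \<open>0\<close> gains one power of \<open>x\<close>.\<close>

lemma C_diff_flat_bound:
  assumes "C_diff m f" "\<And>x. x < 0 \<Longrightarrow> f x = 0"
  shows "\<exists>C. \<forall>x\<in>{0..1}. cmod (f x) \<le> C * x ^ m"
  using assms
proof (induction m arbitrary: f)
  case 0
  then have "compact (f ` {0..1})"
    by (intro compact_continuous_image) (auto intro: continuous_on_subset)
  then show ?case
    by (auto dest!: compact_imp_bounded simp: bounded_iff)
next
  case (Suc m)
  then obtain f' where f': "\<And>x. (f has_vector_derivative f' x) (at x)" "C_diff m f'" by auto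
  have "f' x = 0" if "x < 0" for x
  proof -
    have "(f has_vector_derivative 0) (at x)"
      using has_vector_derivative_transform_within_open[of "\<lambda>_. 0" 0 x "{..<0}" f] Suc.prems(2) that
      by auto
    with f'(1) show ?thesis by (rule vector_derivative_unique_at)
  qed
  with Suc.IH f'(2) obtain C where C: "\<And>x. x \<in> {0..1} \<Longrightarrow> cmod (f' x) \<le> C * x ^ m" by blast
  \<comment> \<open>The sign makes \<open>C * y ^ m\<close> increasing in \<open>y\<close>, so its
    value at the right endpoint bounds the derivative on all of \<open>{0..x}\<close>.\<close>
  have "C \<ge> 0" using C[of 1] norm_ge_zero[of "f' 1"] by simp (meson order_trans norm_ge_zero)
  have "f 0 = 0"
  proof -
    have "(f \<longlongrightarrow> f 0) (at_left 0)"
      using has_vector_derivative_continuous[OF f'(1)]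
      by (meson continuous_within_subset subset_UNIV continuous_within)
    moreover have "(f \<longlongrightarrow> 0) (at_left 0)"
      by (rule tendsto_eventually) (auto simp: eventually_at_filter Suc.prems(2))
    ultimately show ?thesis using tendsto_unique trivial_limit_at_left_real by blast
  qed
  have "cmod (f x) \<le> C * x ^ Suc m" if "x \<in> {0..1}" for x
  proof -
    have "norm (f x - f 0) \<le> (C * x ^ m) * norm (x - 0)"
    proof (rule differentiable_bound)
      show "(f has_derivative (\<lambda>h. h *\<^sub>R f' y)) (at y within {0..x})" for y
        using f'(1) unfolding has_vector_derivative_def by (rule has_derivative_at_withinI)
      show "onorm (\<lambda>h. h *\<^sub>R f' y) \<le> C * x ^ m" if "y \<in> {0..x}" for y
      proof (rule onorm_le)
        have "norm (f' y) \<le> C * y ^ m" using that \<open>x \<in> {0..1}\<close> by (intro C) auto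
        also have "\<dots> \<le> C * x ^ m" using that \<open>C \<ge> 0\<close> by (intro mult_left_mono power_mono) auto
        finally show "norm (h *\<^sub>R f' y) \<le> C * x ^ m * norm h" for h :: real
          by (simp add: mult.commute[of _ "\<bar>h\<bar>"] mult_left_mono)
      qed
    qed (use that in auto)
    with that show ?thesis by (simp add: \<open>f 0 = 0\<close> mult_ac)
  qed
  then show ?case by blast
qed

text \<open>Bundles the two alternative regularity hypotheses, so that reflection and the edge
  estimate handle them together.\<close>

definition regular :: "real \<Rightarrow> (real \<Rightarrow> complex) \<Rightarrow> bool" where
  "regular \<mu> \<phi> \<longleftrightarrow> hoelder_continuous \<mu> \<phi> \<or> (\<exists>m :: nat. \<mu> = real m \<and> C_diff m \<phi>)"

lemma regular_reflect:
  assumes "regular \<mu> \<phi>"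
  shows "regular \<mu> (\<lambda>x. \<phi> (- x))"
proof -
  have "hoelder_continuous \<mu> (\<lambda>x. \<phi> (- x))" if "hoelder_continuous \<mu> \<phi>"
    using that unfolding hoelder_continuous_def
    by (metis abs_minus_commute minus_diff_minus abs_minus_cancel)
  moreover have "C_diff m (\<lambda>x. \<phi> (- x))" if "C_diff m \<phi>" for m
    using C_diff_affine[OF that, of 1 "-1" 0] by simp
  ultimately show ?thesis using assms by (auto simp: regular_def)
qed

lemma regular_edge_bound:
  assumes "regular \<mu> \<phi>" and "AE x in lebesgue. x < a \<longrightarrow> \<phi> x = 0"
  shows "\<exists>C. AE x in lebesgue. 0 < x \<and> x < 1 \<longrightarrow> cmod (\<phi> (a + x)) \<le> C * x powr \<mu>"
  using assms(1) unfolding regular_def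
proof (elim disjE exE conjE)
  assume "hoelder_continuous \<mu> \<phi>"
  then obtain M where M: "\<And>x y. cmod (\<phi> x - \<phi> y) \<le> M * \<bar>x - y\<bar> powr \<mu>"
    unfolding hoelder_continuous_def by blast
  \<comment> \<open>The comparison point is the mirror image \<open>a - x\<close>, at distance
    \<open>2 * x\<close>, rather than \<open>a\<close>: for exponent \<open>0\<close> a
    discontinuous \<open>\<phi>\<close> may be nonzero at \<open>a\<close> itself.\<close>
  have "AE x in lebesgue. a - x < a \<longrightarrow> \<phi> (a - x) = 0"
    using AE_lebesgue_affine[OF assms(2), of "-1" a] by simp
  then have "AE x in lebesgue. 0 < x \<and> x < 1 \<longrightarrow> cmod (\<phi> (a + x)) \<le> (M * 2 powr \<mu>) * x powr \<mu>"
  proof eventually_elim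
    case (elim x)
    then show ?case using M[of "a + x" "a - x"] by (auto simp: powr_mult mult_ac)
  qed
  then show ?thesis ..
next
  fix m assume m: "\<mu> = real m" "C_diff m \<phi>"
  \<comment> \<open>Continuity upgrades vanishing almost everywhere to vanishing everywhere, as the
    pointwise flatness bound requires.\<close>
  have "\<phi> x = 0" if "x < a" for x
    using continuous_AE_zero_imp_zero[of \<phi> "{..<a}" x] C_diff_imp_continuous[OF m(2)] assms(2) that by simp
  then obtain C where "\<forall>x\<in>{0..1}. cmod (\<phi> (a + x)) \<le> C * x ^ m"
    using C_diff_flat_bound[of m "\<lambda>x. \<phi> (a + x)"] C_diff_affine[OF m(2), of 1 1 a]
    by (auto simp: add.commute)
  then show ?thesis
    by (intro exI[of _ C] AE_I2) (auto simp: m(1) powr_realpow)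
qed

text \<open>
  Indexing by the smallest shift \<open>\<beta> k0\<close> with nonzero coefficient, rather than by \<open>0\<close>, covers the
  reflected equation (where \<open>k0 = N\<close>) and the case \<open>c 0 = 0\<close> needed for smooth solutions.
\<close>

lemma edge_coefficient_bound:
  fixes \<phi> :: "real \<Rightarrow> complex"
  assumes "lam > 1" and "two_scale_solution N lam c \<beta> \<phi>" and "regular \<mu> \<phi>"
    and "AE x in lebesgue. x < t0 \<longrightarrow> \<phi> x = 0" and "\<not> (AE x in lebesgue. \<phi> x = 0)"
    and "k0 \<le> N" "c k0 \<noteq> 0"
    and "\<And>k. k \<le> N \<Longrightarrow> k \<noteq> k0 \<Longrightarrow> c k \<noteq> 0 \<Longrightarrow> \<beta> k0 < \<beta> k"
  shows "cmod (c k0) * lam powr \<mu> \<le> 1"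
proof -
  obtain a where a: "AE x in lebesgue. x < a \<longrightarrow> \<phi> x = 0"
    "\<And>t. t > a \<Longrightarrow> \<not> (AE x in lebesgue. x < t \<longrightarrow> \<phi> x = 0)"
    using left_edge_exists[OF assms(4,5)] by blast
  obtain \<delta> where \<delta>: "\<delta> > 0" "AE x in lebesgue. x < \<delta> \<longrightarrow> \<phi> (a + x) = c k0 * \<phi> (a + lam * x)"
    using two_scale_at_left_edge[OF assms(1,2,6,7,8) a] by blast
  obtain C where "AE x in lebesgue. 0 < x \<and> x < 1 \<longrightarrow> cmod (\<phi> (a + x)) \<le> C * x powr \<mu>"
    using regular_edge_bound[OF assms(3) a(1)] by blast
  with assms(1) \<delta>(1) _ _ \<delta>(2) show ?thesis
  proof (rule scaling_factor_le)
    show "AE x in lebesgue. x < 0 \<longrightarrow> \<phi> (a + x) = 0"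
      using AE_lebesgue_affine[OF a(1), of 1 a] by (simp add: add.commute)
    show "\<not> (AE x in lebesgue. x < t \<longrightarrow> \<phi> (a + x) = 0)" if "t > 0" for t
    proof
      assume "AE x in lebesgue. x < t \<longrightarrow> \<phi> (a + x) = 0"
      from AE_lebesgue_affine[OF this, of 1 "- a"]
      have "AE x in lebesgue. x < a + t \<longrightarrow> \<phi> x = 0" by (simp add: algebra_simps)
      with a(2)[of "a + t"] that show False by simp
    qed
  qed
qed

section \<open>Reflection, logarithms and the two conclusions\<close>

text \<open>Reflection negates the shifts and keeps the coefficients, so the largest shift becomes
  the smallest.\<close>

lemma two_scale_solution_reflect:
  assumes "two_scale_solution N lam c \<beta> \<phi>"
  shows "two_scale_solution N lam c (\<lambda>k. - \<beta> k) (\<lambda>x. \<phi> (- x))"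
  using AE_lebesgue_affine[OF assms[unfolded two_scale_solution_def], of "-1" 0]
  by (simp add: two_scale_solution_def minus_diff_commute)

text \<open>The product bound is assumed only for \<open>z \<noteq> 0\<close>; at
  \<open>z = 0\<close> the right-hand side is infinite.\<close>

lemma ereal_le_neg_ln_div:
  assumes "lam > 1" and "z \<noteq> 0 \<Longrightarrow> cmod z * lam powr \<mu> \<le> 1"
  shows "ereal \<mu> \<le> neg_ln (cmod z) / ereal (ln lam)"
proof (cases "z = 0")
  case True
  then show ?thesis using assms(1) by (simp add: neg_ln_def)
next
  case False
  have "ln (cmod z * lam powr \<mu>) \<le> 0"
    using assms False by (subst ln_le_zero_iff) auto
  then have "\<mu> * ln lam \<le> - ln (cmod z)"
    using False assms(1) by (simp add: ln_mult ln_powr)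
  then show ?thesis
    using False assms(1) by (simp add: neg_ln_def field_simps)
qed

theorem corollary2p2:
  fixes N :: nat and lam :: real and c :: "nat \<Rightarrow> complex" and \<beta> :: "nat \<Rightarrow> real"
  assumes "N \<ge> 1" and "lam > 1" and "strict_mono_on {0..N} \<beta>"
  shows
    "(\<forall>(\<phi> :: real \<Rightarrow> complex) (\<mu> :: real).
        L1_nonzero \<phi> \<longrightarrow> ess_compactly_supported \<phi> \<longrightarrow> two_scale_solution N lam c \<beta> \<phi> \<longrightarrow> \<mu> \<ge> 0 \<longrightarrow>
        (hoelder_continuous \<mu> \<phi> \<or> (\<exists>m :: nat. \<mu> = real m \<and> C_diff m \<phi>)) \<longrightarrow>
        ereal \<mu> \<le> min (neg_ln (cmod (c 0))) (neg_ln (cmod (c N))) / ereal (ln lam))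
     \<and> \<not> (\<exists>\<phi> \<in> Cc_infinity - {\<lambda>x. 0}. two_scale_solution N lam c \<beta> \<phi>)"
proof (intro conjI allI impI notI)
  fix \<phi> :: "real \<Rightarrow> complex" and \<mu> :: real
  assume nz: "L1_nonzero \<phi>" and supp: "ess_compactly_supported \<phi>"
    and sol: "two_scale_solution N lam c \<beta> \<phi>"
    and "hoelder_continuous \<mu> \<phi> \<or> (\<exists>m :: nat. \<mu> = real m \<and> C_diff m \<phi>)"
  then have reg: "regular \<mu> \<phi>" by (simp add: regular_def)
  obtain K where "compact K" and K: "AE x in lebesgue. x \<notin> K \<longrightarrow> \<phi> x = 0"
    using supp unfolding ess_compactly_supported_def by blast
  then obtain B where B: "\<And>x. x \<in> K \<Longrightarrow> \<bar>x\<bar> \<le> B"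
    by (auto dest!: compact_imp_bounded simp: bounded_iff) blast
  have left: "AE x in lebesgue. x < - B \<longrightarrow> \<phi> x = 0"
    using K by eventually_elim (use B in force)
  have "AE x in lebesgue. x > B \<longrightarrow> \<phi> x = 0"
    using K by eventually_elim (use B in force)
  then have right: "AE x in lebesgue. x < - B \<longrightarrow> \<phi> (- x) = 0"
    using AE_lebesgue_affine[of "\<lambda>x. x > B \<longrightarrow> \<phi> x = 0" "-1" 0] by (simp add: less_minus_iff[of B])
  have nz1: "\<not> (AE x in lebesgue. \<phi> x = 0)" using nz by (simp add: L1_nonzero_def)
  then have nz2: "\<not> (AE x in lebesgue. \<phi> (- x) = 0)"
    using AE_lebesgue_affine[of "\<lambda>x. \<phi> (- x) = 0" "-1" 0] by auto
  have "ereal \<mu> \<le> neg_ln (cmod (c 0)) / ereal (ln lam)"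
    using edge_coefficient_bound[OF assms(2) sol reg left nz1, of 0] strict_mono_onD[OF assms(3)]
    by (intro ereal_le_neg_ln_div[OF assms(2)]) auto
  moreover have "ereal \<mu> \<le> neg_ln (cmod (c N)) / ereal (ln lam)"
    using edge_coefficient_bound[OF assms(2) two_scale_solution_reflect[OF sol] regular_reflect[OF reg]
        right nz2, of N] strict_mono_onD[OF assms(3)]
    by (intro ereal_le_neg_ln_div[OF assms(2)]) auto
  ultimately show "ereal \<mu> \<le> min (neg_ln (cmod (c 0))) (neg_ln (cmod (c N))) / ereal (ln lam)"
    by (simp add: min_def)
next
  assume "\<exists>\<phi> \<in> Cc_infinity - {\<lambda>x. 0}. two_scale_solution N lam c \<beta> \<phi>"
  then obtain \<phi> where smooth: "\<And>m. C_diff m \<phi>" and cpt: "compact (closure {x. \<phi> x \<noteq> 0})"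
    and "\<phi> \<noteq> (\<lambda>x. 0)" and sol: "two_scale_solution N lam c \<beta> \<phi>"
    by (auto simp: Cc_infinity_def)
  have cont: "continuous_on UNIV \<phi>" using smooth[of 0] by simp
  have nz: "\<not> (AE x in lebesgue. \<phi> x = 0)"
  proof
    assume "AE x in lebesgue. \<phi> x = 0"
    then have "\<phi> x = 0" for x
      using continuous_AE_zero_imp_zero[OF cont, of UNIV x] by simp
    with \<open>\<phi> \<noteq> (\<lambda>x. 0)\<close> show False by blast
  qed
  obtain B where B: "\<And>x. \<phi> x \<noteq> 0 \<Longrightarrow> \<bar>x\<bar> \<le> B"
    using bounded_subset[OF compact_imp_bounded[OF cpt] closure_subset] by (auto simp: bounded_iff)
  have left: "AE x in lebesgue. x < - B \<longrightarrow> \<phi> x = 0"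
    using B by (intro AE_I2) force
  \<comment> \<open>The coefficient \<open>c 0\<close> may vanish, so the first nonzero one takes
    its place; if all vanished, \<open>\<phi>\<close> would be zero almost everywhere.\<close>
  define k0 where "k0 = (LEAST k. k \<le> N \<and> c k \<noteq> 0)"
  have "\<exists>k. k \<le> N \<and> c k \<noteq> 0"
  proof (rule ccontr)
    assume "\<not> ?thesis"
    with sol nz show False by (simp add: two_scale_solution_def)
  qed
  then have k0: "k0 \<le> N" "c k0 \<noteq> 0"
    unfolding k0_def by (metis (mono_tags, lifting) LeastI_ex)+
  have "\<beta> k0 < \<beta> k" if "k \<le> N" "k \<noteq> k0" "c k \<noteq> 0" for k
  proof -
    have "k0 \<le> k" unfolding k0_def using that by (intro Least_le) auto
    with that k0 strict_mono_onD[OF assms(3), of k0 k] show ?thesis by auto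
  qed
  then have "cmod (c k0) * lam powr real m \<le> 1" for m
    using edge_coefficient_bound[OF assms(2) sol _ left nz k0, of "real m"] smooth
    by (auto simp: regular_def)
  \<comment> \<open>The index \<open>k0\<close> does not depend on \<open>m\<close>, so all powers
    of \<open>lam > 1\<close> get one common bound.\<close>
  then have "lam ^ m \<le> 1 / cmod (c k0)" for m
    using k0 assms(2) by (simp add: powr_realpow field_simps)
  then show False
    using real_arch_pow[OF assms(2)] by (meson not_less)
qed

end
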